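(* Let $V$ be a real Euclidean vector space of dimension $n$, let $\Phi\subseteq V$ be a root system and let $\mathcal{W}$ be the finite reflection group defined by $\Phi$, with homogeneous basic invariants of degrees $1\le d_1\le\dots\le d_n$. Let $\underline{o}$ and $\overline{o}$ be the smallest and largest odd numbers among the degrees $d_1,\dots,d_n$, and set $\underline{o}=\overline{o}=1$ if all the $d_i$ are even. If $2d\ge\max(2d_n,2(\underline{o}+\overline{o}))$, then there exists a $\mathcal{W}$-invariant homogeneous polynomial $F$ on $V$ of degree $2d$ which is nonnegative on $\mathcal{H}_{\mathcal{W}}$ and which is negative at some point of $V$, where $\mathcal{H}_{\mathcal{W}}$ is the union of the hyperplanes in $V$ perpendicular to the elements of $\Phi$.
   Context: A root system $\Phi\subseteq V$ is a finite set of vectors such that the only multiples of $v\in\Phi$ lying in $\Phi$ are $\pm v$, and $\Phi$ is mapped to itself by the orthogonal reflection $w\mapsto w-2\frac{\langle w,v\rangle}{\langle v,v\rangle}v$ for each $v\in\Phi$. The reflection group $\mathcal{W}$ is the subgroup of $\operatorname{GL}(V)$ generated by these reflections; it acts on polynomials by $(wf)(x)=f(w^{-1}x)$. By Chevalley's theorem the invariant algebra is generated by $n$ algebraically independent homogeneous invariants (basic invariants), whose degrees are uniquely determined by $\mathcal{W}$. *)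

theory Defs
  imports "HOL-Analysis.Analysis" "HOL-Algebra.Generated_Groups" "HOL-Library.Poly_Mapping"
begin

definition reflection :: "'a::euclidean_space \<Rightarrow> 'a \<Rightarrow> 'a" where
  "reflection v w = w - (2 * (w \<bullet> v) / (v \<bullet> v)) *\<^sub>R v"

text \<open>Roots are nonzero, since the reflection in a root divides by its squared length. The roots
  need not span the space, and there is no integrality condition.\<close>

definition root_system :: "'a::euclidean_space set \<Rightarrow> bool" where
  "root_system \<Phi> \<longleftrightarrow>
     finite \<Phi> \<and> 0 \<notin> \<Phi> \<and>
     (\<forall>v\<in>\<Phi>. range (\<lambda>c::real. c *\<^sub>R v) \<inter> \<Phi> = {v, - v}) \<and>
     (\<forall>v\<in>\<Phi>. reflection v ` \<Phi> = \<Phi>)"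

definition GL :: "('a::euclidean_space \<Rightarrow> 'a) monoid" where
  "GL = \<lparr>carrier = {g. linear g \<and> bij g}, monoid.mult = (\<circ>), one = id\<rparr>"

definition reflection_group :: "'a::euclidean_space set \<Rightarrow> ('a \<Rightarrow> 'a) set" where
  "reflection_group \<Phi> = generate GL (reflection ` \<Phi>)"

definition reflection_hyperplanes :: "'a::euclidean_space set \<Rightarrow> 'a set" where
  "reflection_hyperplanes \<Phi> = (\<Union>v\<in>\<Phi>. {x. v \<bullet> x = 0})"

definition act :: "('a \<Rightarrow> 'a) \<Rightarrow> ('a \<Rightarrow> real) \<Rightarrow> 'a \<Rightarrow> real" where
  "act w f = (\<lambda>x. f (inv_into UNIV w x))"

definition invariant_under :: "('a \<Rightarrow> 'a) set \<Rightarrow> ('a \<Rightarrow> real) \<Rightarrow> bool" where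
  "invariant_under W f \<longleftrightarrow> (\<forall>w\<in>W. act w f = f)"

text \<open>Polynomials on a real vector space are identified with polynomial functions. The zero
  polynomial is homogeneous of every degree.\<close>

definition homogeneous_polynomial :: "nat \<Rightarrow> ('a::euclidean_space \<Rightarrow> real) \<Rightarrow> bool" where
  "homogeneous_polynomial k f \<longleftrightarrow>
     real_polynomial_function f \<and> (\<forall>c x. f (c *\<^sub>R x) = c ^ k * f x)"

text \<open>Elements of \<^typ>\<open>(nat \<Rightarrow>\<^sub>0 nat) \<Rightarrow>\<^sub>0 real\<close> are polynomials in the variables
  $X_0, X_1, \ldots$, given by the coefficient of each exponent vector.\<close>

definition polys_in :: "nat set \<Rightarrow> ((nat \<Rightarrow>\<^sub>0 nat) \<Rightarrow>\<^sub>0 real) set" where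
  "polys_in I = {P. \<forall>m\<in>Poly_Mapping.keys P. Poly_Mapping.keys m \<subseteq> I}"

definition eval_poly :: "((nat \<Rightarrow>\<^sub>0 nat) \<Rightarrow>\<^sub>0 real) \<Rightarrow> (nat \<Rightarrow> real) \<Rightarrow> real" where
  "eval_poly P y =
     (\<Sum>m\<in>Poly_Mapping.keys P.
        Poly_Mapping.lookup P m * (\<Prod>i\<in>Poly_Mapping.keys m. y i ^ Poly_Mapping.lookup m i))"

definition algebraically_independent :: "nat set \<Rightarrow> (nat \<Rightarrow> 'a \<Rightarrow> real) \<Rightarrow> bool" where
  "algebraically_independent I f \<longleftrightarrow>
     (\<forall>P\<in>polys_in I. (\<forall>x. eval_poly P (\<lambda>i. f i x) = 0) \<longrightarrow> P = 0)"

definition generated_algebra :: "nat set \<Rightarrow> (nat \<Rightarrow> 'a \<Rightarrow> real) \<Rightarrow> ('a \<Rightarrow> real) set" where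
  "generated_algebra I f = (\<lambda>P x. eval_poly P (\<lambda>i. f i x)) ` polys_in I"

definition invariant_algebra :: "('a::euclidean_space \<Rightarrow> 'a) set \<Rightarrow> ('a \<Rightarrow> real) set" where
  "invariant_algebra W = {f. real_polynomial_function f \<and> invariant_under W f}"

definition basic_invariants ::
    "('a::euclidean_space \<Rightarrow> 'a) set \<Rightarrow> (nat \<Rightarrow> 'a \<Rightarrow> real) \<Rightarrow> (nat \<Rightarrow> nat) \<Rightarrow> bool" where
  "basic_invariants W f deg \<longleftrightarrow>
     (\<forall>i\<in>{1..DIM('a)}. homogeneous_polynomial (deg i) (f i) \<and> invariant_under W (f i)) \<and>
     algebraically_independent {1..DIM('a)} f \<and>
     generated_algebra {1..DIM('a)} f = invariant_algebra W"

definition smallest_odd_degree :: "nat \<Rightarrow> (nat \<Rightarrow> nat) \<Rightarrow> nat" where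
  "smallest_odd_degree n deg =
     (if \<forall>i\<in>{1..n}. even (deg i) then 1 else Min {k \<in> deg ` {1..n}. odd k})"

definition largest_odd_degree :: "nat \<Rightarrow> (nat \<Rightarrow> nat) \<Rightarrow> nat" where
  "largest_odd_degree n deg =
     (if \<forall>i\<in>{1..n}. even (deg i) then 1 else Max {k \<in> deg ` {1..n}. odd k})"

end

theory Submission
  imports Defs
begin

text \<open>
  Fix a unit vector \<open>p\<close> off all mirrors at which the odd invariant \<open>g\<close> of least degree does not
  vanish. If \<open>x\<close> is a unit vector that agrees with \<open>p\<close> on the basic invariants of even degree and
  on the products of \<open>g\<close> with the basic invariants of odd degree, then all basic invariants agree
  at \<open>x\<close> and at one of \<open>p\<close>, \<open>- p\<close>. The product of all roots, viewed as linear forms, is an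
  invariant and hence a polynomial in the basic invariants; as it does not vanish at \<open>p\<close> and
  \<open>- p\<close>, such an \<open>x\<close> lies on no mirror. All functions compared here have even degree at most \<open>d\<close>,
  so the squares of the differences can be homogenised to degree \<open>2 * d\<close> with powers of
  \<open>x \<bullet> x\<close>. Their sum vanishes at \<open>p\<close> and is bounded below by some \<open>\<epsilon> > 0\<close> on the unit vectors of
  the mirrors; subtracting \<open>\<epsilon> * (x \<bullet> x) ^ d\<close> gives the required form.
\<close>

section \<open>Reflections and the group they generate\<close>

lemma inner_reflection: "reflection v x \<bullet> y = x \<bullet> reflection v y"
  by (simp add: reflection_def inner_diff_left inner_diff_right inner_commute)

lemma reflection_reflection: "v \<noteq> 0 \<Longrightarrow> reflection v (reflection v x) = x"
  by (simp add: reflection_def inner_diff_left algebra_simps)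

lemma linear_reflection: "linear (reflection v)"
  by (rule linearI)
    (simp_all add: reflection_def inner_add_left algebra_simps add_divide_distrib)

lemma bij_reflection: "v \<noteq> 0 \<Longrightarrow> bij (reflection v)"
  by (rule o_bij[where g = "reflection v"]) (auto simp: reflection_reflection)

text \<open>\<open>m_inv\<close> is a definite description, so the involution is checked directly to
  be the only two-sided inverse, without establishing a group structure on
  \<open>GL\<close>.\<close>

lemma inv_GL_reflection:
  assumes "v \<noteq> 0"
  shows "inv\<^bsub>GL\<^esub> (reflection v) = reflection v"
  unfolding m_inv_def
proof (rule the_equality)
  show "reflection v \<in> carrier GL \<and> reflection v \<otimes>\<^bsub>GL\<^esub> reflection v = \<one>\<^bsub>GL\<^esub> \<and>
      reflection v \<otimes>\<^bsub>GL\<^esub> reflection v = \<one>\<^bsub>GL\<^esub>"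
    using assms by (auto simp: GL_def linear_reflection bij_reflection reflection_reflection)
next
  fix h
  assume "h \<in> carrier GL \<and> reflection v \<otimes>\<^bsub>GL\<^esub> h = \<one>\<^bsub>GL\<^esub> \<and> h \<otimes>\<^bsub>GL\<^esub> reflection v = \<one>\<^bsub>GL\<^esub>"
  then have "reflection v (h x) = x" for x
    by (auto simp: GL_def fun_eq_iff)
  then show "h = reflection v"
    by (metis assms ext reflection_reflection)
qed

text \<open>Reflections are involutions, so the case of inverse generators in
  \<open>generate\<close> collapses into the case of generators.\<close>

lemma reflection_group_induct [consumes 2, case_names id reflection comp]:
  assumes "w \<in> reflection_group \<Phi>" "0 \<notin> \<Phi>"
    and "P id" "\<And>v. v \<in> \<Phi> \<Longrightarrow> P (reflection v)" "\<And>g h. P g \<Longrightarrow> P h \<Longrightarrow> P (g \<circ> h)"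
  shows "P w"
  using assms(1) unfolding reflection_group_def
proof (induction rule: generate.induct)
  case one
  then show ?case using assms(3) unfolding GL_def monoid.select_convs .
next
  case (incl h)
  then show ?case using assms(4) by auto
next
  case (inv h)
  then obtain v where "v \<in> \<Phi>" "h = reflection v" by auto
  then show ?case using assms(2,4) inv_GL_reflection by metis
next
  case (eng g h)
  then show ?case unfolding GL_def monoid.select_convs by (intro assms(5))
qed

lemma bij_reflection_group:
  assumes "w \<in> reflection_group \<Phi>" "0 \<notin> \<Phi>"
  shows "bij w"
  using assms
proof (induction rule: reflection_group_induct)
  case (reflection v)
  then show ?case using assms(2) bij_reflection by metis
qed (rule bij_id, rule bij_comp)

text \<open>The maps under which f is unchanged are closed under composition, so generators suffice.
  Bijectivity lets the inverse in \<open>act\<close> cancel.\<close>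

lemma invariant_under_reflection_group_iff:
  assumes "0 \<notin> \<Phi>"
  shows "invariant_under (reflection_group \<Phi>) f \<longleftrightarrow> (\<forall>v\<in>\<Phi>. \<forall>x. f (reflection v x) = f x)"
proof
  assume *: "invariant_under (reflection_group \<Phi>) f"
  show "\<forall>v\<in>\<Phi>. \<forall>x. f (reflection v x) = f x"
  proof (intro ballI allI)
    fix v x assume v: "v \<in> \<Phi>"
    then have "reflection v \<in> reflection_group \<Phi>"
      by (auto simp: reflection_group_def intro: generate.incl)
    then have "act (reflection v) f (reflection v x) = f (reflection v x)"
      using * by (simp add: invariant_under_def)
    moreover have "bij (reflection v)"
      using v assms bij_reflection by metis
    ultimately show "f (reflection v x) = f x"
      by (simp add: act_def bij_is_inj)
  qed
next
  assume *: "\<forall>v\<in>\<Phi>. \<forall>x. f (reflection v x) = f x"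
  have "act w f = f" if w: "w \<in> reflection_group \<Phi>" for w
  proof
    fix x
    have "\<forall>x. f (w x) = f x"
      using w assms by (induction rule: reflection_group_induct) (use * in auto)
    then have "f (inv_into UNIV w x) = f (w (inv_into UNIV w x))"
      by simp
    then show "act w f x = f x"
      using bij_reflection_group[OF w assms] by (simp add: act_def bij_is_surj surj_f_inv_f)
  qed
  then show "invariant_under (reflection_group \<Phi>) f"
    by (simp add: invariant_under_def)
qed

section \<open>The product of the roots as an invariant\<close>

lemma real_polynomial_function_inner_left: "real_polynomial_function (\<lambda>x. v \<bullet> x)"
  by (rule real_polynomial_function.intros(1)) (rule bounded_linear_inner_right)

lemma real_polynomial_function_inner_self:
  "real_polynomial_function (\<lambda>x::'a::euclidean_space. x \<bullet> x)"
proof -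
  have "(\<lambda>x::'a. x \<bullet> x) = (\<lambda>x. \<Sum>b\<in>Basis. (b \<bullet> x) * (b \<bullet> x))"
    by (subst euclidean_inner) (simp add: inner_commute)
  then show ?thesis
    by (simp add: real_polynomial_function_sum real_polynomial_function.intros(4)
        real_polynomial_function_inner_left)
qed

text \<open>For a root system this is, up to sign, the square of the product over the positive
  roots. The latter is invariant only up to the determinant.\<close>

definition root_product :: "'a::euclidean_space set \<Rightarrow> 'a \<Rightarrow> real" where
  "root_product \<Phi> x = (\<Prod>v\<in>\<Phi>. v \<bullet> x)"

lemma root_product_eq_0_iff:
  "finite \<Phi> \<Longrightarrow> root_product \<Phi> x = 0 \<longleftrightarrow> x \<in> reflection_hyperplanes \<Phi>"
  by (auto simp: root_product_def reflection_hyperplanes_def)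

text \<open>A reflection is self-adjoint, so it can be moved from x to the roots, whose factors it
  merely permutes.\<close>

lemma root_product_in_invariant_algebra:
  assumes "root_system \<Phi>"
  shows "root_product \<Phi> \<in> invariant_algebra (reflection_group \<Phi>)"
proof -
  have fin: "finite \<Phi>" and nz: "0 \<notin> \<Phi>"
    using assms by (auto simp: root_system_def)
  have "real_polynomial_function (\<lambda>x. \<Prod>v\<in>\<Phi>. v \<bullet> x)"
    using fin by (intro real_polynomial_function_prod real_polynomial_function_inner_left)
  then have "real_polynomial_function (root_product \<Phi>)"
    by (simp add: root_product_def[abs_def])
  moreover have "root_product \<Phi> (reflection v x) = root_product \<Phi> x" if v: "v \<in> \<Phi>" for v x
  proof -
    have "bij_betw (reflection v) \<Phi> \<Phi>"
      unfolding bij_betw_def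
    proof
      have "v \<noteq> 0" using v nz by auto
      then show "inj_on (reflection v) \<Phi>"
        using bij_reflection bij_is_inj inj_on_subset by blast
      show "reflection v ` \<Phi> = \<Phi>"
        using assms v by (simp add: root_system_def)
    qed
    then have "(\<Prod>u\<in>\<Phi>. reflection v u \<bullet> x) = (\<Prod>u\<in>\<Phi>. u \<bullet> x)"
      by (rule prod.reindex_bij_betw)
    then show ?thesis
      by (simp add: root_product_def inner_reflection)
  qed
  ultimately show ?thesis
    by (simp add: invariant_algebra_def invariant_under_reflection_group_iff[OF nz])
qed

section \<open>What the values of the basic invariants determine\<close>

lemma eval_poly_cong:
  assumes "P \<in> polys_in I" "\<And>i. i \<in> I \<Longrightarrow> y i = z i"
  shows "eval_poly P y = eval_poly P z"
  unfolding eval_poly_def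
proof (intro sum.cong refl arg_cong2[where f = "(*)"] prod.cong)
  fix m i
  assume "m \<in> Poly_Mapping.keys P" "i \<in> Poly_Mapping.keys m"
  then have "i \<in> I"
    using assms(1) by (auto simp: polys_in_def)
  then show "y i ^ Poly_Mapping.lookup m i = z i ^ Poly_Mapping.lookup m i"
    using assms(2) by simp
qed

lemma algebraically_independent_nonzero:
  assumes "algebraically_independent I f" "i \<in> I"
  shows "\<exists>x. f i x \<noteq> 0"
proof (rule ccontr)
  assume "\<not> ?thesis"
  then have z: "f i x = 0" for x by auto
  \<comment> \<open>The single variable with index i: if \<open>f i\<close> vanished identically,
    this would be an algebraic relation.\<close>
  define P :: "(nat \<Rightarrow>\<^sub>0 nat) \<Rightarrow>\<^sub>0 real"
    where "P = Poly_Mapping.single (Poly_Mapping.single i 1) 1"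
  have "P \<in> polys_in I"
    using assms(2) by (auto simp: polys_in_def P_def)
  moreover have "eval_poly P (\<lambda>i. f i x) = 0" for x
    by (simp add: eval_poly_def P_def z)
  ultimately have "P = 0"
    using assms(1) by (auto simp: algebraically_independent_def)
  then have "Poly_Mapping.lookup P (Poly_Mapping.single i 1) = 0" by simp
  then show False by (simp add: P_def)
qed

text \<open>Since the basic invariants generate, their values at a point determine that of
  \<open>root_product\<close>, whose zero set is the union of the mirrors.\<close>

lemma basic_invariants_separate_hyperplanes:
  fixes \<Phi> :: "'a::euclidean_space set"
  assumes "root_system \<Phi>" "basic_invariants (reflection_group \<Phi>) f deg"
    and "x \<in> reflection_hyperplanes \<Phi>" "\<And>i. i \<in> {1..DIM('a)} \<Longrightarrow> f i x = f i y"
  shows "y \<in> reflection_hyperplanes \<Phi>"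
proof -
  have fin: "finite \<Phi>" using assms(1) by (simp add: root_system_def)
  have "root_product \<Phi> \<in> generated_algebra {1..DIM('a)} f"
    using root_product_in_invariant_algebra[OF assms(1)] assms(2)
    by (simp add: basic_invariants_def)
  then obtain P where P: "P \<in> polys_in {1..DIM('a)}"
    and eq: "root_product \<Phi> = (\<lambda>x. eval_poly P (\<lambda>i. f i x))"
    by (auto simp: generated_algebra_def)
  have "root_product \<Phi> x = root_product \<Phi> y"
    unfolding eq using P assms(4) by (intro eval_poly_cong) auto
  then show ?thesis
    using assms(3) root_product_eq_0_iff[OF fin] by metis
qed

section \<open>Topology of the mirrors and closure properties of homogeneous polynomials\<close>

lemma closed_reflection_hyperplanes: "finite \<Phi> \<Longrightarrow> closed (reflection_hyperplanes \<Phi>)"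
  unfolding reflection_hyperplanes_def by (intro closed_UN ballI closed_hyperplane)

lemma negligible_reflection_hyperplanes:
  "finite \<Phi> \<Longrightarrow> 0 \<notin> \<Phi> \<Longrightarrow> negligible (reflection_hyperplanes \<Phi>)"
  unfolding reflection_hyperplanes_def
  by (intro negligible_Union) (auto intro!: negligible_hyperplane)

lemma scaleR_in_reflection_hyperplanes_iff:
  "c \<noteq> 0 \<Longrightarrow> c *\<^sub>R x \<in> reflection_hyperplanes \<Phi> \<longleftrightarrow> x \<in> reflection_hyperplanes \<Phi>"
  by (auto simp: reflection_hyperplanes_def)

lemma homogeneous_polynomial_continuous_on:
  "homogeneous_polynomial k g \<Longrightarrow> continuous_on S g"
  by (simp add: homogeneous_polynomial_def continuous_on_polymonial_function
      real_polynomial_function_eq)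

lemma homogeneous_polynomial_uminus:
  "homogeneous_polynomial k g \<Longrightarrow> g (- x) = (- 1) ^ k * g x"
  unfolding homogeneous_polynomial_def by (metis scaleR_minus1_left)

lemma homogeneous_polynomial_mult:
  "homogeneous_polynomial k g \<Longrightarrow> homogeneous_polynomial l h \<Longrightarrow>
    homogeneous_polynomial (k + l) (\<lambda>x. g x * h x)"
  by (auto simp: homogeneous_polynomial_def power_add real_polynomial_function.intros(4))

lemma homogeneous_polynomial_power:
  "homogeneous_polynomial k g \<Longrightarrow> homogeneous_polynomial (k * l) (\<lambda>x. g x ^ l)"
  by (auto simp: homogeneous_polynomial_def power_mult power_mult_distrib
      intro: real_polynomial_function_power)

lemma homogeneous_polynomial_diff:
  "homogeneous_polynomial k g \<Longrightarrow> homogeneous_polynomial k h \<Longrightarrow>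
    homogeneous_polynomial k (\<lambda>x. g x - h x)"
  by (auto simp: homogeneous_polynomial_def right_diff_distrib
      intro: real_polynomial_function_diff)

lemma homogeneous_polynomial_cmult:
  "homogeneous_polynomial k g \<Longrightarrow> homogeneous_polynomial k (\<lambda>x. c * g x)"
  by (auto simp: homogeneous_polynomial_def real_polynomial_function.intros(2,4))

lemma homogeneous_polynomial_sum:
  "finite I \<Longrightarrow> (\<And>i. i \<in> I \<Longrightarrow> homogeneous_polynomial k (g i)) \<Longrightarrow>
    homogeneous_polynomial k (\<lambda>x. \<Sum>i\<in>I. g i x)"
  by (auto simp: homogeneous_polynomial_def sum_distrib_left intro: real_polynomial_function_sum)

lemma homogeneous_polynomial_inner_self_power:
  "homogeneous_polynomial (2 * k) (\<lambda>x::'a::euclidean_space. (x \<bullet> x) ^ k)"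
  by (rule homogeneous_polynomial_power)
    (simp add: homogeneous_polynomial_def real_polynomial_function_inner_self power2_eq_square)

section \<open>Construction of a form that is negative off the mirrors\<close>

lemma ex_unit_vector_off_hyperplanes:
  fixes \<Phi> :: "'a::euclidean_space set"
  assumes "finite \<Phi>" "0 \<notin> \<Phi>" "homogeneous_polynomial k g" "g y \<noteq> 0"
  obtains p where "p \<bullet> p = 1" "p \<notin> reflection_hyperplanes \<Phi>" "g p \<noteq> 0"
proof -
  have "open {x. g x \<noteq> 0}"
    using homogeneous_polynomial_continuous_on[OF assms(3)]
    by (intro open_Collect_neq continuous_on_const)
  then have "\<not> negligible {x. g x \<noteq> 0}"
    using assms(4) open_not_negligible by auto
  \<comment> \<open>The origin is added explicitly: for empty \<Phi> it lies on no mirror, yet q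
    must be nonzero to be normalised.\<close>
  moreover have "negligible (insert 0 (reflection_hyperplanes \<Phi>))"
    using negligible_reflection_hyperplanes[OF assms(1,2)] by simp
  ultimately obtain q where q: "g q \<noteq> 0" "q \<noteq> 0" "q \<notin> reflection_hyperplanes \<Phi>"
    using negligible_subset[of "insert 0 (reflection_hyperplanes \<Phi>)" "{x. g x \<noteq> 0}"] by auto
  define p where "p = inverse (norm q) *\<^sub>R q"
  show thesis
  proof
    show "p \<bullet> p = 1"
      using q(2) by (simp add: p_def dot_square_norm power2_eq_square)
    show "p \<notin> reflection_hyperplanes \<Phi>"
      using q by (simp add: p_def scaleR_in_reflection_hyperplanes_iff)
    show "g p \<noteq> 0"
      using q assms(3) by (simp add: p_def homogeneous_polynomial_def)
  qed
qed

text \<open>The analytic core, shared by both parity cases of the theorem: it turns invariants of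
  even degree that separate p from the unit vectors on the mirrors into the form F.\<close>

lemma homogeneous_negative_off_hyperplanes:
  fixes \<Phi> :: "'a::euclidean_space set" and q :: "'i \<Rightarrow> 'a \<Rightarrow> real"
  assumes \<Phi>: "root_system \<Phi>" and I: "finite I" and "d \<noteq> 0"
    and q: "\<And>i. i \<in> I \<Longrightarrow> homogeneous_polynomial (2 * e i) (q i)"
      "\<And>i. i \<in> I \<Longrightarrow> invariant_under (reflection_group \<Phi>) (q i)"
    and e: "\<And>i. i \<in> I \<Longrightarrow> 2 * e i \<le> d"
    and p: "p \<bullet> p = 1"
    and sep: "\<And>x. \<lbrakk>x \<in> reflection_hyperplanes \<Phi>; x \<bullet> x = 1\<rbrakk> \<Longrightarrow> \<exists>i\<in>I. q i x \<noteq> q i p"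
  shows "\<exists>F. homogeneous_polynomial (2 * d) F \<and> invariant_under (reflection_group \<Phi>) F \<and>
    (\<forall>x\<in>reflection_hyperplanes \<Phi>. F x \<ge> 0) \<and> F p < 0"
proof -
  have fin: "finite \<Phi>" and nz: "0 \<notin> \<Phi>"
    using \<Phi> by (auto simp: root_system_def)
  \<comment> \<open>On the unit sphere each summand is the squared difference of
    \<open>q i x\<close> and \<open>q i p\<close>. The even degree of \<open>q i\<close> allows the
    constant \<open>q i p\<close> to be homogenised by a power of
    \<open>x \<bullet> x\<close>.\<close>
  define G where
    "G x = (\<Sum>i\<in>I. (x \<bullet> x) ^ (d - 2 * e i) * (q i x - q i p * (x \<bullet> x) ^ e i) ^ 2)" for x
  have G: "homogeneous_polynomial (2 * d) G"
    unfolding G_def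
  proof (rule homogeneous_polynomial_sum[OF I])
    fix i assume i: "i \<in> I"
    have "homogeneous_polynomial (2 * (d - 2 * e i) + 2 * e i * 2)
        (\<lambda>x. (x \<bullet> x) ^ (d - 2 * e i) * (q i x - q i p * (x \<bullet> x) ^ e i) ^ 2)"
      by (intro homogeneous_polynomial_mult homogeneous_polynomial_power
          homogeneous_polynomial_diff homogeneous_polynomial_cmult
          homogeneous_polynomial_inner_self_power q i)
    \<comment> \<open>The bound on \<open>e i\<close> ensures that the natural-number subtraction is
      not truncated.\<close>
    also have "2 * (d - 2 * e i) + 2 * e i * 2 = 2 * d"
      using e[OF i] by linarith
    finally show "homogeneous_polynomial (2 * d)
        (\<lambda>x. (x \<bullet> x) ^ (d - 2 * e i) * (q i x - q i p * (x \<bullet> x) ^ e i) ^ 2)" .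
  qed
  have pos: "G x > 0" if x: "x \<in> reflection_hyperplanes \<Phi>" "x \<bullet> x = 1" for x
  proof -
    obtain i where "i \<in> I" "q i x \<noteq> q i p" using sep[OF x] by blast
    then show ?thesis
      unfolding G_def using I x(2) by (intro sum_pos2[of I i]) auto
  qed
  \<comment> \<open>The minimum of G over a compact set. If no mirror meets the unit sphere (no
    roots, or dimension one), any positive number serves.\<close>
  obtain \<epsilon> where \<epsilon>: "\<epsilon> > 0"
    "\<And>x. x \<in> reflection_hyperplanes \<Phi> \<Longrightarrow> x \<bullet> x = 1 \<Longrightarrow> \<epsilon> \<le> G x"
  proof (cases "reflection_hyperplanes \<Phi> \<inter> sphere 0 1 = {}")
    case True
    then have "x \<bullet> x \<noteq> 1" if "x \<in> reflection_hyperplanes \<Phi>" for x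
      using that by (auto simp: norm_eq_1)
    then show ?thesis using that[of 1] by auto
  next
    case False
    moreover have "compact (reflection_hyperplanes \<Phi> \<inter> sphere 0 1)"
      using fin by (intro closed_Int_compact closed_reflection_hyperplanes compact_sphere)
    ultimately obtain z where "z \<in> reflection_hyperplanes \<Phi> \<inter> sphere 0 1"
      "\<forall>x\<in>reflection_hyperplanes \<Phi> \<inter> sphere 0 1. G z \<le> G x"
      using continuous_attains_inf homogeneous_polynomial_continuous_on[OF G] by metis
    then show ?thesis
      using that[of "G z"] pos by (auto simp: norm_eq_1)
  qed
  define F where "F x = G x - \<epsilon> * (x \<bullet> x) ^ d" for x
  have F: "homogeneous_polynomial (2 * d) F"
    unfolding F_def by (intro homogeneous_polynomial_diff homogeneous_polynomial_cmult
        homogeneous_polynomial_inner_self_power G)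
  moreover have "invariant_under (reflection_group \<Phi>) F"
    unfolding invariant_under_reflection_group_iff[OF nz]
  proof (intro ballI allI)
    fix v x assume v: "v \<in> \<Phi>"
    then have "v \<noteq> 0" using nz by auto
    then have "reflection v x \<bullet> reflection v x = x \<bullet> x"
      by (simp add: inner_reflection reflection_reflection)
    moreover have "q i (reflection v x) = q i x" if "i \<in> I" for i
      using q(2)[OF that] v by (simp add: invariant_under_reflection_group_iff[OF nz])
    ultimately show "F (reflection v x) = F x"
      by (simp add: F_def G_def)
  qed
  moreover have "F x \<ge> 0" if x: "x \<in> reflection_hyperplanes \<Phi>" for x
  proof (cases "x = 0")
    case True
    \<comment> \<open>The origin cannot be normalised; there F vanishes by homogeneity in positive
      degree.\<close>
    have "F (0 *\<^sub>R x) = 0 ^ (2 * d) * F x"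
      using F unfolding homogeneous_polynomial_def by blast
    moreover have "(0::real) ^ (2 * d) = 0" using \<open>d \<noteq> 0\<close> by (intro zero_power) simp
    ultimately show ?thesis using True by simp
  next
    case False
    define u where "u = inverse (norm x) *\<^sub>R x"
    have "u \<in> reflection_hyperplanes \<Phi>" "u \<bullet> u = 1"
      using False x by (simp_all add: u_def scaleR_in_reflection_hyperplanes_iff
          dot_square_norm power2_eq_square)
    then have "F u \<ge> 0" using \<epsilon>(2) by (simp add: F_def)
    moreover have "x = norm x *\<^sub>R u" using False by (simp add: u_def)
    then have "F x = norm x ^ (2 * d) * F u"
      using F unfolding homogeneous_polynomial_def by metis
    ultimately show ?thesis by simp
  qed
  moreover have "F p < 0"
    using \<epsilon>(1) p by (simp add: F_def G_def)
  ultimately show ?thesis by blast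
qed

section \<open>Choice of the separating invariants according to the parity of the degrees\<close>

theorem theorem1p2:
  fixes \<Phi> :: "'a::euclidean_space set"
    and f :: "nat \<Rightarrow> 'a \<Rightarrow> real"
    and deg :: "nat \<Rightarrow> nat"
    and n d :: nat
  assumes "n = DIM('a)"
    and "root_system \<Phi>"
    and "basic_invariants (reflection_group \<Phi>) f deg"
    and "\<forall>i\<in>{1..n}. 1 \<le> deg i"
    and "mono_on {1..n} deg"
    and "2 * d \<ge> max (2 * deg n)
                       (2 * (smallest_odd_degree n deg + largest_odd_degree n deg))"
  shows "\<exists>F :: 'a \<Rightarrow> real.
           homogeneous_polynomial (2 * d) F \<and>
           invariant_under (reflection_group \<Phi>) F \<and>
           (\<forall>x\<in>reflection_hyperplanes \<Phi>. F x \<ge> 0) \<and>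
           (\<exists>x. F x < 0)"
proof -
  have fin: "finite \<Phi>" and nz: "0 \<notin> \<Phi>"
    using assms(2) by (auto simp: root_system_def)
  have n: "n \<in> {1..n}"
    using assms(1) DIM_positive[where 'a = 'a] by simp
  have hom: "homogeneous_polynomial (deg i) (f i)"
    and inv: "invariant_under (reflection_group \<Phi>) (f i)" if "i \<in> {1..n}" for i
    using assms(1,3) that by (auto simp: basic_invariants_def)
  have deg_le: "deg i \<le> d" if "i \<in> {1..n}" for i
  proof -
    have "deg i \<le> deg n" using assms(5) that n by (auto simp: mono_on_def)
    then show ?thesis using assms(6) by simp
  qed
  have "d \<noteq> 0" using deg_le[OF n] assms(4) n by fastforce
  have sep: "x \<notin> reflection_hyperplanes \<Phi>"
    if "\<And>i. i \<in> {1..n} \<Longrightarrow> f i x = f i y" "y \<notin> reflection_hyperplanes \<Phi>" for x y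
    using basic_invariants_separate_hyperplanes[OF assms(2,3)] that assms(1) by blast
  show ?thesis
  proof (cases "\<forall>i\<in>{1..n}. even (deg i)")
    case True
    \<comment> \<open>With all degrees even there is no sign ambiguity to resolve, so the constant 1
      stands in for the invariant that must not vanish at p.\<close>
    have "homogeneous_polynomial 0 (\<lambda>x::'a. 1)"
      by (simp add: homogeneous_polynomial_def real_polynomial_function.intros(2))
    then obtain p :: 'a where p: "p \<bullet> p = 1" "p \<notin> reflection_hyperplanes \<Phi>"
      using ex_unit_vector_off_hyperplanes[OF fin nz] by (metis zero_neq_one)
    have "\<exists>F. homogeneous_polynomial (2 * d) F \<and> invariant_under (reflection_group \<Phi>) F \<and>
        (\<forall>x\<in>reflection_hyperplanes \<Phi>. F x \<ge> 0) \<and> F p < 0"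
    proof (rule homogeneous_negative_off_hyperplanes[where I = "{1..n}" and q = f
          and e = "\<lambda>i. deg i div 2", OF assms(2) _ \<open>d \<noteq> 0\<close>])
      show "\<exists>i\<in>{1..n}. f i x \<noteq> f i p" if "x \<in> reflection_hyperplanes \<Phi>" for x
        using sep p(2) that by blast
    qed (use True hom inv deg_le p in auto)
    then show ?thesis by blast
  next
    case False
    define odds where "odds = {k \<in> deg ` {1..n}. odd k}"
    have odds: "finite odds" "odds \<noteq> {}" using False by (auto simp: odds_def)
    then obtain m where m: "m \<in> {1..n}" "deg m = Min odds" "odd (deg m)"
      using Min_in[OF odds] unfolding odds_def by auto
    \<comment> \<open>The products of \<open>f m\<close> with the odd invariants have these degrees;
      the hypothesis on the smallest and largest odd degree bounds them by d.\<close>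
    have deg_add_le: "deg m + deg i \<le> d" if "i \<in> {1..n}" "odd (deg i)" for i
    proof -
      have "deg i \<le> Max odds" using that odds by (auto simp: odds_def)
      moreover have "Min odds + Max odds \<le> d"
        using assms(6)
        unfolding smallest_odd_degree_def largest_odd_degree_def if_not_P[OF False] odds_def
        by simp
      ultimately show ?thesis using m(2) by simp
    qed
    obtain y where "f m y \<noteq> 0"
      using algebraically_independent_nonzero[of "{1..n}" f m] assms(1,3) m(1)
      by (auto simp: basic_invariants_def)
    then obtain p where p: "p \<bullet> p = 1" "p \<notin> reflection_hyperplanes \<Phi>" "f m p \<noteq> 0"
      using ex_unit_vector_off_hyperplanes[OF fin nz hom[OF m(1)]] by metis
    \<comment> \<open>A sum of two odd degrees is even, so the division by 2 is exact in both
      branches.\<close>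
    define e where "e i = (if even (deg i) then deg i else deg m + deg i) div 2" for i
    define q where "q i = (if even (deg i) then f i else (\<lambda>x. f m x * f i x))" for i
    have e: "2 * e i = (if even (deg i) then deg i else deg m + deg i)" for i
      using m(3) by (auto simp: e_def)
    have "\<exists>F. homogeneous_polynomial (2 * d) F \<and> invariant_under (reflection_group \<Phi>) F \<and>
        (\<forall>x\<in>reflection_hyperplanes \<Phi>. F x \<ge> 0) \<and> F p < 0"
    proof (rule homogeneous_negative_off_hyperplanes[where I = "{1..n}" and q = q and e = e,
          OF assms(2) _ \<open>d \<noteq> 0\<close>])
      fix i assume i: "i \<in> {1..n}"
      show "homogeneous_polynomial (2 * e i) (q i)"
        unfolding e using hom i m(1) by (auto simp: q_def intro: homogeneous_polynomial_mult)
      show "invariant_under (reflection_group \<Phi>) (q i)"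
        using inv[OF i] inv[OF m(1)]
        by (auto simp: q_def invariant_under_reflection_group_iff[OF nz])
      show "2 * e i \<le> d"
        unfolding e using deg_le deg_add_le i by auto
    next
      fix x assume x: "x \<in> reflection_hyperplanes \<Phi>"
      show "\<exists>i\<in>{1..n}. q i x \<noteq> q i p"
      proof (rule ccontr)
        assume "\<not> ?thesis"
        then have eq: "q i x = q i p" if "i \<in> {1..n}" for i using that by blast
        have even: "f i x = f i p" if "i \<in> {1..n}" "even (deg i)" for i
          using eq[OF that(1)] that(2) by (simp add: q_def)
        have odd: "f m x * f i x = f m p * f i p" if "i \<in> {1..n}" "odd (deg i)" for i
          using eq[OF that(1)] that(2) by (simp add: q_def)
        \<comment> \<open>The product with index m is the square of \<open>f m\<close>, which fixes
          \<open>f m x\<close> up to sign.\<close>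
        have "f m x * f m x = f m p * f m p" using odd m by blast
        then consider "f m x = f m p" | "f m x = - f m p"
          using square_eq_iff by blast
        then show False
        proof cases
          case 1
          \<comment> \<open>The nonzero factor \<open>f m p\<close> cancels from the
            products.\<close>
          then have "f i x = f i p" if "i \<in> {1..n}" for i
            using even odd that p(3) by (cases "even (deg i)") auto
          then show False using sep p(2) x by blast
        next
          case 2
          \<comment> \<open>Passing from p to its antipode keeps the even invariants and flips the
            odd ones. This matches the sign left after cancelling \<open>f m p\<close>.\<close>
          have "f i x = f i (- p)" if "i \<in> {1..n}" for i
          proof (cases "even (deg i)")
            case True
            then show ?thesis
              using even that homogeneous_polynomial_uminus[OF hom[OF that]] by simp
          next
            case False
            then have "f m p * (- f i x) = f m p * f i p"
              using odd[OF that] 2 by simp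
            then have "- f i x = f i p" using p(3) mult_left_cancel by blast
            then have "f i x = - f i p" by simp
            then show ?thesis
              using False homogeneous_polynomial_uminus[OF hom[OF that]] by simp
          qed
          moreover have "- p \<notin> reflection_hyperplanes \<Phi>"
            using p(2) scaleR_in_reflection_hyperplanes_iff[of "- 1" p \<Phi>] by simp
          ultimately show False using sep x by blast
        qed
      qed
    qed (use p in auto)
    then show ?thesis by blast
  qed
qed

end
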